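(* Let $n\ge2$ and let $\alpha$ be an ordinal. (a) Every first-order $\mathcal L_{n,S}$-formula over $\mathfrak T_\alpha^n$ can be translated into an MSO formula over $(\alpha,<)$: for every $\mathcal L_{n,S}$-formula $\varphi(x_1,\dots,x_k)$ there is an MSO formula $\varphi^*(\bar X^1,\dots,\bar X^k)$, with each $\bar X^j$ an $n$-tuple of set variables, such that for all nodes $s_1,\dots,s_k$ of $\mathfrak T_\alpha^n$, $\mathfrak T_\alpha^n\models\varphi(s_1,\dots,s_k)$ iff $(\alpha,<)\models\varphi^*(\bar X(s_1),\dots,\bar X(s_k))$. (b) Conversely, every MSO formula over $(\alpha,<)$ can be translated into a first-order $\mathcal L_{n,S}\cup\{\sim\}$-formula over $(\mathfrak T_{\alpha+1}^n,\sim)$: for every MSO formula $\psi(v_1,\dots,v_k,V_1,\dots,V_l)$ there is a first-order $\mathcal L_{n,S}\cup\{\sim\}$-formula $\psi^*(y_1,\dots,y_k,z_1,\dots,z_l)$ such that for all $\beta_1,\dots,\beta_k<\alpha$ and $A_1,\dots,A_l\subseteq\alpha$, $(\alpha,<)\models\psi(\beta_1,\dots,\beta_k,A_1,\dots,A_l)$ iff $(\mathfrak T_{\alpha+1}^n,\sim)\models\psi^*(c_{\{\beta_1\}},\dots,c_{\{\beta_k\}},c_{A_1},\dots,c_{A_l})$.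
   Context: $\mathcal L_{n,S}=\{\subseteq,S_0,\dots,S_{n-1}\}$. $\mathfrak T_\alpha^n=(n^{<\alpha},\subseteq,S_0,\dots,S_{n-1})$, where $n^{<\alpha}$ is the set of functions $s:\beta\to n=\{0,\dots,n-1\}$ with $\beta<\alpha$ (the height of $s$ is $\operatorname{ht}(s)=\beta$), $\subseteq$ is inclusion, and $S_i(s)$ is $s$ extended by one further entry $i$; when $\alpha$ is not a limit ordinal, $S_i$ is undefined on nodes of maximal height and is understood through its graph $E_i(x,y)\Leftrightarrow y=S_i(x)$, as a binary relation. $x\sim y$ means $\operatorname{ht}(x)=\operatorname{ht}(y)$. MSO (monadic second-order logic) over $(\alpha,<)$ has first-order variables ranging over elements of $\alpha$ and set variables ranging over subsets of $\alpha$. The code of a node $s:\beta\to n$ is the $n$-tuple $\bar X(s)=(X_0,\dots,X_{n-1})$ with $X_i=\{\gamma<\beta:s(\gamma)=i\}$. For $A\subseteq\alpha$, $c_A:\alpha\to n$ is the node of height $\alpha$ of $\mathfrak T_{\alpha+1}^n$ with $c_A(\gamma)=1$ if $\gamma\in A$ and $c_A(\gamma)=0$ otherwise. *)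

theory Defs
  imports Main
begin

text \<open>
  An ordinal \<open>\<alpha>\<close> is given by a well-order \<open>r\<close> (reflexive, as in the library) of order type
  \<open>\<alpha>\<close>.  The elements of \<open>\<alpha>\<close> are those of \<open>Field r\<close>; the ordinal \<open>\<beta> < \<alpha>\<close>, regarded as
  the set of its predecessors, is \<open>underS r \<beta>\<close>.  The well-order may be empty, so \<open>\<alpha> = 0\<close>
  is included.
\<close>

text \<open>The ordinal \<open>\<alpha> + 1\<close>: \<open>r\<close> with a new greatest element \<open>None\<close>.\<close>

definition ord_succ :: "'a rel \<Rightarrow> 'a option rel" where
  "ord_succ r = {(Some x, Some y) | x y. (x, y) \<in> r}
      \<union> {(Some x, None) | x. x \<in> Field r} \<union> {(None, None)}"

type_synonym 'a node = "'a \<rightharpoonup> nat"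

definition nodes :: "nat \<Rightarrow> 'a rel \<Rightarrow> 'a node set" where
  "nodes n r = {s. (\<exists>\<beta> \<in> Field r. dom s = underS r \<beta>) \<and> ran s \<subseteq> {..<n}}"

definition ht :: "'a rel \<Rightarrow> 'a node \<Rightarrow> 'a" where
  "ht r s = (THE \<beta>. \<beta> \<in> Field r \<and> dom s = underS r \<beta>)"

text \<open>The partial function \<open>S\<^sub>i\<close>; it is undefined exactly where the extended sequence is no
  longer a node, i.e. on nodes of maximal height.\<close>

definition succ_node :: "nat \<Rightarrow> 'a rel \<Rightarrow> nat \<Rightarrow> 'a node \<Rightarrow> 'a node option" where
  "succ_node n r i s =
     (let t = s(ht r s \<mapsto> i) in if t \<in> nodes n r then Some t else None)"

definition code :: "'a node \<Rightarrow> nat \<Rightarrow> 'a set" where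
  "code s i = {\<gamma>. s \<gamma> = Some i}"

text \<open>\<open>c\<^sub>A\<close>, a node of height \<open>\<alpha>\<close> (that is, of height \<open>None\<close>) over \<open>\<alpha> + 1\<close>.\<close>

definition char_node :: "'a rel \<Rightarrow> 'a set \<Rightarrow> 'a option node" where
  "char_node r A = (\<lambda>p. case p of None \<Rightarrow> None
      | Some \<gamma> \<Rightarrow> if \<gamma> \<in> Field r then Some (if \<gamma> \<in> A then 1 else 0) else None)"


text \<open>
  First-order formulas over \<open>\<subseteq>\<close>, \<open>S\<^sub>0, S\<^sub>1, \<dots>\<close> and \<open>\<sim>\<close>, with variables named by natural
  numbers.  The \<open>S\<^sub>i\<close> are available both as function symbols (\<open>TSucc\<close>) and through their
  graphs \<open>E\<^sub>i\<close> (\<open>TEdge\<close>).  The missing connectives and quantifiers are definable from the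
  given ones.
\<close>

datatype tree_term = TVar nat | TSucc nat tree_term

datatype tree_form =
    TEq tree_term tree_term
  | TSub tree_term tree_term
  | TEdge nat tree_term tree_term
  | TSim tree_term tree_term
  | TNeg tree_form
  | TConj tree_form tree_form
  | TEx nat tree_form

primrec tvars :: "tree_term \<Rightarrow> nat set" where
  "tvars (TVar x) = {x}"
| "tvars (TSucc i t) = tvars t"

primrec tree_fv :: "tree_form \<Rightarrow> nat set" where
  "tree_fv (TEq t u) = tvars t \<union> tvars u"
| "tree_fv (TSub t u) = tvars t \<union> tvars u"
| "tree_fv (TEdge i t u) = tvars t \<union> tvars u"
| "tree_fv (TSim t u) = tvars t \<union> tvars u"
| "tree_fv (TNeg \<phi>) = tree_fv \<phi>"
| "tree_fv (TConj \<phi> \<psi>) = tree_fv \<phi> \<union> tree_fv \<psi>"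
| "tree_fv (TEx x \<phi>) = tree_fv \<phi> - {x}"

text \<open>Only the symbols \<open>S\<^sub>i\<close> and \<open>E\<^sub>i\<close> with \<open>i < n\<close> occur.\<close>

primrec term_over :: "nat \<Rightarrow> tree_term \<Rightarrow> bool" where
  "term_over n (TVar x) \<longleftrightarrow> True"
| "term_over n (TSucc i t) \<longleftrightarrow> i < n \<and> term_over n t"

primrec form_over :: "nat \<Rightarrow> tree_form \<Rightarrow> bool" where
  "form_over n (TEq t u) \<longleftrightarrow> term_over n t \<and> term_over n u"
| "form_over n (TSub t u) \<longleftrightarrow> term_over n t \<and> term_over n u"
| "form_over n (TEdge i t u) \<longleftrightarrow> i < n \<and> term_over n t \<and> term_over n u"
| "form_over n (TSim t u) \<longleftrightarrow> term_over n t \<and> term_over n u"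
| "form_over n (TNeg \<phi>) \<longleftrightarrow> form_over n \<phi>"
| "form_over n (TConj \<phi> \<psi>) \<longleftrightarrow> form_over n \<phi> \<and> form_over n \<psi>"
| "form_over n (TEx x \<phi>) \<longleftrightarrow> form_over n \<phi>"

primrec sim_free :: "tree_form \<Rightarrow> bool" where
  "sim_free (TEq t u) \<longleftrightarrow> True"
| "sim_free (TSub t u) \<longleftrightarrow> True"
| "sim_free (TEdge i t u) \<longleftrightarrow> True"
| "sim_free (TSim t u) \<longleftrightarrow> False"
| "sim_free (TNeg \<phi>) \<longleftrightarrow> sim_free \<phi>"
| "sim_free (TConj \<phi> \<psi>) \<longleftrightarrow> sim_free \<phi> \<and> sim_free \<psi>"
| "sim_free (TEx x \<phi>) \<longleftrightarrow> sim_free \<phi>"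

text \<open>The \<open>S\<^sub>i\<close> occur only through their graphs \<open>E\<^sub>i\<close>, so every term is a variable.\<close>

primrec is_var :: "tree_term \<Rightarrow> bool" where
  "is_var (TVar x) \<longleftrightarrow> True"
| "is_var (TSucc i t) \<longleftrightarrow> False"

primrec relational :: "tree_form \<Rightarrow> bool" where
  "relational (TEq t u) \<longleftrightarrow> is_var t \<and> is_var u"
| "relational (TSub t u) \<longleftrightarrow> is_var t \<and> is_var u"
| "relational (TEdge i t u) \<longleftrightarrow> is_var t \<and> is_var u"
| "relational (TSim t u) \<longleftrightarrow> is_var t \<and> is_var u"
| "relational (TNeg \<phi>) \<longleftrightarrow> relational \<phi>"
| "relational (TConj \<phi> \<psi>) \<longleftrightarrow> relational \<phi> \<and> relational \<psi>"
| "relational (TEx x \<phi>) \<longleftrightarrow> relational \<phi>"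

primrec tree_val :: "nat \<Rightarrow> 'a rel \<Rightarrow> (nat \<Rightarrow> 'a node) \<Rightarrow> tree_term \<Rightarrow> 'a node option" where
  "tree_val n r e (TVar x) = Some (e x)"
| "tree_val n r e (TSucc i t) = Option.bind (tree_val n r e t) (succ_node n r i)"

text \<open>
  Satisfaction in the tree over \<open>n\<close> and \<open>r\<close>.  An atomic formula with an undefined term is
  false, so that a function symbol stands for its graph: for instance \<open>S\<^sub>i(x) \<subseteq> y\<close> means
  that some node \<open>z\<close> satisfies \<open>E\<^sub>i(x,z)\<close> and \<open>z \<subseteq> y\<close>.  If the ordinal is a limit,
  all terms are defined and this is the usual semantics.
\<close>

primrec tree_sat :: "nat \<Rightarrow> 'a rel \<Rightarrow> (nat \<Rightarrow> 'a node) \<Rightarrow> tree_form \<Rightarrow> bool" where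
  "tree_sat n r e (TEq t u) \<longleftrightarrow>
     (\<exists>a b. tree_val n r e t = Some a \<and> tree_val n r e u = Some b \<and> a = b)"
| "tree_sat n r e (TSub t u) \<longleftrightarrow>
     (\<exists>a b. tree_val n r e t = Some a \<and> tree_val n r e u = Some b \<and> a \<subseteq>\<^sub>m b)"
| "tree_sat n r e (TEdge i t u) \<longleftrightarrow>
     (\<exists>a b. tree_val n r e t = Some a \<and> tree_val n r e u = Some b \<and> succ_node n r i a = Some b)"
| "tree_sat n r e (TSim t u) \<longleftrightarrow>
     (\<exists>a b. tree_val n r e t = Some a \<and> tree_val n r e u = Some b \<and> ht r a = ht r b)"
| "tree_sat n r e (TNeg \<phi>) \<longleftrightarrow> \<not> tree_sat n r e \<phi>"
| "tree_sat n r e (TConj \<phi> \<psi>) \<longleftrightarrow> tree_sat n r e \<phi> \<and> tree_sat n r e \<psi>"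
| "tree_sat n r e (TEx x \<phi>) \<longleftrightarrow> (\<exists>s \<in> nodes n r. tree_sat n r (e(x := s)) \<phi>)"


text \<open>
  MSO formulas over \<open>(\<alpha>,<)\<close>.  Element variables and set variables are two separate sorts,
  each named by natural numbers.
\<close>

datatype mso_form =
    MEq nat nat
  | MLess nat nat
  | MMem nat nat  \<comment> \<open>element variable, set variable\<close>
  | MNeg mso_form
  | MConj mso_form mso_form
  | MEx nat mso_form
  | MExSet nat mso_form

primrec mso_fv :: "mso_form \<Rightarrow> nat set" where
  "mso_fv (MEq x y) = {x, y}"
| "mso_fv (MLess x y) = {x, y}"
| "mso_fv (MMem x X) = {x}"
| "mso_fv (MNeg \<phi>) = mso_fv \<phi>"
| "mso_fv (MConj \<phi> \<psi>) = mso_fv \<phi> \<union> mso_fv \<psi>"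
| "mso_fv (MEx x \<phi>) = mso_fv \<phi> - {x}"
| "mso_fv (MExSet X \<phi>) = mso_fv \<phi>"

primrec mso_set_fv :: "mso_form \<Rightarrow> nat set" where
  "mso_set_fv (MEq x y) = {}"
| "mso_set_fv (MLess x y) = {}"
| "mso_set_fv (MMem x X) = {X}"
| "mso_set_fv (MNeg \<phi>) = mso_set_fv \<phi>"
| "mso_set_fv (MConj \<phi> \<psi>) = mso_set_fv \<phi> \<union> mso_set_fv \<psi>"
| "mso_set_fv (MEx x \<phi>) = mso_set_fv \<phi>"
| "mso_set_fv (MExSet X \<phi>) = mso_set_fv \<phi> - {X}"

primrec mso_sat :: "'a rel \<Rightarrow> (nat \<Rightarrow> 'a) \<Rightarrow> (nat \<Rightarrow> 'a set) \<Rightarrow> mso_form \<Rightarrow> bool" where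
  "mso_sat r v V (MEq x y) \<longleftrightarrow> v x = v y"
| "mso_sat r v V (MLess x y) \<longleftrightarrow> (v x, v y) \<in> r \<and> v x \<noteq> v y"
| "mso_sat r v V (MMem x X) \<longleftrightarrow> v x \<in> V X"
| "mso_sat r v V (MNeg \<phi>) \<longleftrightarrow> \<not> mso_sat r v V \<phi>"
| "mso_sat r v V (MConj \<phi> \<psi>) \<longleftrightarrow> mso_sat r v V \<phi> \<and> mso_sat r v V \<psi>"
| "mso_sat r v V (MEx x \<phi>) \<longleftrightarrow> (\<exists>a \<in> Field r. mso_sat r (v(x := a)) V \<phi>)"
| "mso_sat r v V (MExSet X \<phi>) \<longleftrightarrow> (\<exists>A. A \<subseteq> Field r \<and> mso_sat r v (V(X := A)) \<phi>)"


text \<open>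
  Variables are counted from 0.  The tuple belonging to the node variable \<open>j\<close> consists of
  the set variables \<open>j * n, \<dots>, j * n + (n - 1)\<close>; those belonging to the first \<open>k\<close> node
  variables are the set variables below \<open>k * n\<close>.
\<close>

definition code_env :: "nat \<Rightarrow> (nat \<Rightarrow> 'a node) \<Rightarrow> nat \<Rightarrow> 'a set" where
  "code_env n s m = code (s (m div n)) (m mod n)"

text \<open>The node variables \<open>y\<close> are the first \<open>k\<close> variables, and the variables \<open>z\<close> follow them.\<close>

definition char_env ::
  "'a rel \<Rightarrow> nat \<Rightarrow> (nat \<Rightarrow> 'a) \<Rightarrow> (nat \<Rightarrow> 'a set) \<Rightarrow> nat \<Rightarrow> 'a option node" where
  "char_env r k v A m =
     (if m < k then char_node r {v m} else char_node r (A (m - k)))"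

end

theory Submission
  imports Defs
begin

text \<open>
  For (a), function symbols are first eliminated in favour of their graphs, after which a node
  quantifier becomes a quantifier over \<open>n\<close>-tuples of sets that partition a proper initial segment.
  For (b), a set \<open>A\<close> may be represented by any node whose entries equal to \<open>1\<close> are exactly those
  at the positions in \<open>A\<close>.  Since the translated formula refers to a node only through these
  positions, the range of a translated set quantifier need not be restricted to the nodes
  \<open>c\<^sub>A\<close>.
\<close>

section \<open>Nodes of a tree over a well-order\<close>

text \<open>Definedness shapes (a): over a non-limit ordinal a term may lack a value, and then every
  atom containing it is false. Flattening moves this into existential quantifiers, which find no
  witness when an intermediate node is missing; what remains depends only on the codes of the
  variables. A code determines the height of its node, because the union of its sets is the domain.
  In (b), nodes of full height \<alpha> are what lets unbounded subsets of \<alpha> be represented.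
  A position of a node y is reached as the height of a proper initial segment u of y, and it carries
  the entry 1 iff S_1(u) is contained in y. Positions of two different nodes may lie on different
  branches, so they are compared by \<open>~\<close>.\<close>

lemma underS_inj:
  assumes "Well_order r" "a \<in> Field r" "b \<in> Field r" "underS r a = underS r b"
  shows "a = b"
proof (rule ccontr)
  assume "a \<noteq> b"
  then have "(a, b) \<in> r \<or> (b, a) \<in> r"
    using assms by (auto simp: well_order_on_def linear_order_on_def total_on_def)
  then have "a \<in> underS r b \<or> b \<in> underS r a"
    using \<open>a \<noteq> b\<close> by (auto simp: underS_def)
  then show False using assms(4) by (auto simp: underS_def)
qed

lemma underS_trans:
  assumes "Well_order r" "c \<in> underS r b" "b \<in> underS r a"
  shows "c \<in> underS r a"
  using assms
  by (auto simp: underS_def well_order_on_def linear_order_on_def partial_order_on_def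
      preorder_on_def antisym_def dest: transD)

text \<open>The witness is the immediate successor of \<open>c\<close>, the least element strictly
  above it; it exists because \<open>b\<close> is above \<open>c\<close>. Hence a node that is not
  of maximal height can always be extended, even when the ordinal is not a limit.\<close>

lemma insert_underS:
  assumes "Well_order r" "c \<in> underS r b"
  obtains d where "d \<in> Field r" "underS r d = insert c (underS r c)"
proof -
  let ?Q = "{d. c \<in> underS r d}"
  have lin: "total_on (Field r) r" and wf: "wf (r - Id)"
    using assms(1) by (auto simp: well_order_on_def linear_order_on_def partial_order_on_def)
  have "b \<in> ?Q" using assms(2) by simp
  then obtain d where d: "d \<in> ?Q" "\<And>y. (y, d) \<in> r - Id \<Longrightarrow> y \<notin> ?Q"
    using wf by (metis wf_eq_minimal)
  have field: "c \<in> Field r" "d \<in> Field r"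
    using d(1) by (auto simp: underS_def Field_def)
  have "y = c \<or> y \<in> underS r c" if "y \<in> underS r d" for y
  proof -
    have "y \<in> Field r" "(y, d) \<in> r - Id"
      using that by (auto simp: underS_def Field_def)
    then have "c \<notin> underS r y" using d(2) by auto
    then show ?thesis
      using lin field(1) \<open>y \<in> Field r\<close> by (auto simp: underS_def total_on_def)
  qed
  moreover have "underS r c \<subseteq> underS r d"
    using underS_trans[OF assms(1)] d(1) by blast
  ultimately have "underS r d = insert c (underS r c)"
    using d(1) by auto
  then show thesis using that field(2) by blast
qed

lemma ht_eq:
  assumes "Well_order r" "b \<in> Field r" "dom s = underS r b"
  shows "ht r s = b"
  unfolding ht_def using assms by (auto intro!: the_equality dest: underS_inj)

lemma node_ht:
  assumes "Well_order r" "s \<in> nodes n r"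
  shows "ht r s \<in> Field r" "dom s = underS r (ht r s)"
  using assms ht_eq[OF assms(1)] by (auto simp: nodes_def)

lemma node_val_less:
  assumes "s \<in> nodes n r" "s c = Some i"
  shows "i < n"
  using assms by (auto simp: nodes_def ran_def)

lemma succ_node_eq_Some_iff:
  "succ_node n r i a = Some b \<longleftrightarrow> b = a(ht r a \<mapsto> i) \<and> b \<in> nodes n r"
  by (auto simp: succ_node_def Let_def)

text \<open>This is how node quantifiers reach positions: every element of the domain of
  \<open>y\<close> is the height of an initial segment of \<open>y\<close>.\<close>

lemma restrict_node:
  assumes wo: "Well_order r" and y: "y \<in> nodes n r" and c: "c \<in> dom y"
  defines "u \<equiv> y |` underS r c"
  shows "u \<in> nodes n r" "ht r u = c" "u \<subseteq>\<^sub>m y"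
proof -
  have cb: "c \<in> underS r (ht r y)" using node_ht[OF wo y] c by auto
  then have field: "c \<in> Field r" by (auto simp: underS_def Field_def)
  have dom: "dom u = underS r c"
    unfolding u_def using node_ht[OF wo y] underS_trans[OF wo _ cb] by auto
  show "u \<in> nodes n r"
    using y dom field by (auto simp: nodes_def u_def ran_def restrict_map_def split: if_splits)
  show "ht r u = c" using wo field dom by (rule ht_eq)
  show "u \<subseteq>\<^sub>m y" by (auto simp: u_def map_le_def)
qed

text \<open>If \<open>y\<close> has an entry at the height of \<open>u\<close>, that height lies
  strictly below the height of \<open>y\<close>, so the successor of \<open>u\<close> is a node.
  Reading an entry of \<open>y\<close> through the partial successor function is therefore never
  hindered by undefinedness.\<close>

lemma succ_node_below_iff:
  assumes wo: "Well_order r" and u: "u \<in> nodes n r" and y: "y \<in> nodes n r"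
  shows "(\<exists>w \<in> nodes n r. succ_node n r i u = Some w \<and> w \<subseteq>\<^sub>m y)
    \<longleftrightarrow> u \<subseteq>\<^sub>m y \<and> y (ht r u) = Some i"
proof
  assume "\<exists>w \<in> nodes n r. succ_node n r i u = Some w \<and> w \<subseteq>\<^sub>m y"
  then have le: "u(ht r u \<mapsto> i) \<subseteq>\<^sub>m y" by (auto simp: succ_node_eq_Some_iff)
  \<comment> \<open>The height of \<open>u\<close> is its first free position, so the update
    overwrites nothing.\<close>
  have "ht r u \<notin> dom u" using node_ht[OF wo u] by (simp add: underS_def)
  then have "u \<subseteq>\<^sub>m u(ht r u \<mapsto> i)" by (auto simp: map_le_def)
  then show "u \<subseteq>\<^sub>m y \<and> y (ht r u) = Some i"
    using le map_le_trans by (fastforce simp: map_le_def)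
next
  assume le: "u \<subseteq>\<^sub>m y \<and> y (ht r u) = Some i"
  then have "ht r u \<in> underS r (ht r y)" using node_ht[OF wo y] by blast
  then obtain d where d: "d \<in> Field r" "underS r d = insert (ht r u) (underS r (ht r u))"
    using insert_underS[OF wo] by metis
  have "ran (u(ht r u \<mapsto> i)) \<subseteq> {..<n}"
    using u le node_val_less[OF y] by (auto simp: nodes_def ran_def split: if_splits)
  moreover have "dom (u(ht r u \<mapsto> i)) = underS r d"
    using d(2) node_ht[OF wo u] by simp
  ultimately have "u(ht r u \<mapsto> i) \<in> nodes n r" using d(1) by (auto simp: nodes_def)
  moreover have "u(ht r u \<mapsto> i) \<subseteq>\<^sub>m y" using le by (auto simp: map_le_def)
  ultimately show "\<exists>w \<in> nodes n r. succ_node n r i u = Some w \<and> w \<subseteq>\<^sub>m y"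
    by (auto simp: succ_node_eq_Some_iff)
qed


section \<open>Elimination of the function symbols\<close>

primrec base_var :: "tree_term \<Rightarrow> nat" where
  "base_var (TVar x) = x"
| "base_var (TSucc i t) = base_var t"

lemma tvars_base_var: "tvars t = {base_var t}"
  by (induction t) auto

text \<open>The variable \<open>y\<close> is meant to lie above \<open>base_var t\<close>, so that
  \<open>Suc y\<close> is fresh for the intermediate value. If that value is undefined, the
  quantifier has no witness and the formula is false.\<close>

primrec term_graph :: "tree_term \<Rightarrow> nat \<Rightarrow> tree_form" where
  "term_graph (TVar x) y = TEq (TVar x) (TVar y)"
| "term_graph (TSucc i t) y =
     TEx (Suc y) (TConj (term_graph t (Suc y)) (TEdge i (TVar (Suc y)) (TVar y)))"

lemma tree_fv_term_graph:
  "base_var t < y \<Longrightarrow> tree_fv (term_graph t y) = {base_var t, y}"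
  by (induction t arbitrary: y) auto

lemma term_graph_over: "term_over n t \<Longrightarrow> form_over n (term_graph t y)"
  by (induction t arbitrary: y) auto

lemma relational_term_graph: "relational (term_graph t y)"
  by (induction t arbitrary: y) auto

lemma tree_val_node:
  "e (base_var t) \<in> nodes n r \<Longrightarrow> tree_val n r e t = Some a \<Longrightarrow> a \<in> nodes n r"
  by (induction t arbitrary: a) (auto simp: bind_eq_Some_conv succ_node_eq_Some_iff)

lemma tree_val_cong:
  "e (base_var t) = e' (base_var t) \<Longrightarrow> tree_val n r e t = tree_val n r e' t"
  by (induction t) auto

lemma tree_sat_term_graph:
  "base_var t < y \<Longrightarrow> e (base_var t) \<in> nodes n r \<Longrightarrow> e y \<in> nodes n r \<Longrightarrow>
    tree_sat n r e (term_graph t y) \<longleftrightarrow> tree_val n r e t = Some (e y)"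
proof (induction t arbitrary: e y)
  case (TVar x)
  then show ?case by auto
next
  case (TSucc i t)
  have val: "tree_val n r (e(Suc y := s)) t = tree_val n r e t" for s
    using TSucc.prems by (intro tree_val_cong) auto
  have sat: "tree_sat n r (e(Suc y := s)) (term_graph t (Suc y)) \<longleftrightarrow> tree_val n r e t = Some s"
    if "s \<in> nodes n r" for s
    using TSucc.IH[of "Suc y" "e(Suc y := s)"] TSucc.prems that
    by (simp add: val del: fun_upd_apply) (simp add: val)
  have "tree_sat n r e (term_graph (TSucc i t) y) \<longleftrightarrow>
      (\<exists>s \<in> nodes n r. tree_val n r e t = Some s \<and> succ_node n r i s = Some (e y))"
    using TSucc.prems sat by auto
  \<comment> \<open>The quantifier ranges over nodes only; nothing is lost, since every value of a
    term over a node is itself a node.\<close>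
  also have "\<dots> \<longleftrightarrow> tree_val n r e (TSucc i t) = Some (e y)"
    using tree_val_node[of e t n r] TSucc.prems by (auto simp: bind_eq_Some_conv)
  finally show ?case .
qed

text \<open>The two existential quantifiers reproduce the convention that an atom with an undefined
  term is false. The first graph may rebind \<open>Suc y\<close> internally; this is harmless,
  because its only free variables are \<open>y\<close> and the variable of \<open>t\<close>.\<close>

definition flatten_atom :: "tree_term \<Rightarrow> tree_term \<Rightarrow> (tree_term \<Rightarrow> tree_term \<Rightarrow> tree_form) \<Rightarrow> tree_form" where
  "flatten_atom t u R =
     (let y = Suc (max (base_var t) (base_var u)) in
      TEx y (TEx (Suc y) (TConj (term_graph t y)
        (TConj (term_graph u (Suc y)) (R (TVar y) (TVar (Suc y)))))))"

text \<open>The predicate \<open>P\<close> abstracts the meaning of the atom \<open>R\<close>, so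
  that one argument serves equality, inclusion, edges and \<open>~\<close>.\<close>

lemma tree_sat_flatten_atom:
  assumes e: "e (base_var t) \<in> nodes n r" "e (base_var u) \<in> nodes n r"
    and R: "\<And>e x y. tree_sat n r e (R (TVar x) (TVar y)) \<longleftrightarrow> P (e x) (e y)"
  shows "tree_sat n r e (flatten_atom t u R) \<longleftrightarrow>
    (\<exists>a b. tree_val n r e t = Some a \<and> tree_val n r e u = Some b \<and> P a b)"
proof -
  define y where "y = Suc (max (base_var t) (base_var u))"
  have y: "base_var t < y" "base_var u < y" by (auto simp: y_def)
  have val: "tree_val n r (e(y := a, Suc y := b)) t = tree_val n r e t"
    "tree_val n r (e(y := a, Suc y := b)) u = tree_val n r e u" for a b
    using y by (auto intro!: tree_val_cong)
  have "tree_sat n r e (flatten_atom t u R) \<longleftrightarrow>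
    (\<exists>a \<in> nodes n r. \<exists>b \<in> nodes n r.
       tree_val n r e t = Some a \<and> tree_val n r e u = Some b \<and> P a b)"
    using y e by (simp add: flatten_atom_def Let_def y_def[symmetric] tree_sat_term_graph val R)
  also have "\<dots> \<longleftrightarrow> (\<exists>a b. tree_val n r e t = Some a \<and> tree_val n r e u = Some b \<and> P a b)"
    using tree_val_node e by blast
  finally show ?thesis .
qed

lemma tree_fv_flatten_atom:
  assumes "\<And>x y. tree_fv (R (TVar x) (TVar y)) = {x, y}"
  shows "tree_fv (flatten_atom t u R) = tvars t \<union> tvars u"
  by (auto simp: flatten_atom_def Let_def assms tree_fv_term_graph tvars_base_var max_def)

primrec flatten :: "tree_form \<Rightarrow> tree_form" where
  "flatten (TEq t u) = flatten_atom t u TEq"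
| "flatten (TSub t u) = flatten_atom t u TSub"
| "flatten (TEdge i t u) = flatten_atom t u (TEdge i)"
| "flatten (TSim t u) = flatten_atom t u TSim"
| "flatten (TNeg \<phi>) = TNeg (flatten \<phi>)"
| "flatten (TConj \<phi> \<psi>) = TConj (flatten \<phi>) (flatten \<psi>)"
| "flatten (TEx x \<phi>) = TEx x (flatten \<phi>)"

lemma relational_flatten: "relational (flatten \<phi>)"
  by (induction \<phi>) (auto simp: flatten_atom_def Let_def relational_term_graph)

lemma form_over_flatten: "form_over n \<phi> \<Longrightarrow> form_over n (flatten \<phi>)"
  by (induction \<phi>) (auto simp: flatten_atom_def Let_def term_graph_over)

lemma tree_fv_flatten: "tree_fv (flatten \<phi>) = tree_fv \<phi>"
  by (induction \<phi>) (simp_all add: tree_fv_flatten_atom insert_commute)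

text \<open>The free variables must denote nodes: flattening introduces quantifiers over nodes, and
  a variable with any other value would have no witness there.\<close>

lemma tree_sat_flatten:
  "\<forall>x \<in> tree_fv \<phi>. e x \<in> nodes n r \<Longrightarrow> tree_sat n r e (flatten \<phi>) \<longleftrightarrow> tree_sat n r e \<phi>"
proof (induction \<phi> arbitrary: e)
  case (TEq t u)
  then show ?case
    by (subst flatten.simps, subst tree_sat_flatten_atom[where P = "(=)"])
      (auto simp: tvars_base_var)
next
  case (TSub t u)
  then show ?case
    by (subst flatten.simps, subst tree_sat_flatten_atom[where P = "(\<subseteq>\<^sub>m)"])
      (auto simp: tvars_base_var)
next
  case (TEdge i t u)
  then show ?case
    by (subst flatten.simps,
        subst tree_sat_flatten_atom[where P = "\<lambda>a b. succ_node n r i a = Some b"])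
      (auto simp: tvars_base_var)
next
  case (TSim t u)
  then show ?case
    by (subst flatten.simps, subst tree_sat_flatten_atom[where P = "\<lambda>a b. ht r a = ht r b"])
      (auto simp: tvars_base_var)
next
  case (TEx x \<phi>)
  have "tree_sat n r (e(x := s)) (flatten \<phi>) \<longleftrightarrow> tree_sat n r (e(x := s)) \<phi>"
    if "s \<in> nodes n r" for s
    using that TEx.prems by (intro TEx.IH) auto
  then show ?case by auto
qed simp_all


section \<open>From the tree to monadic second-order logic\<close>

abbreviation MDisj :: "mso_form \<Rightarrow> mso_form \<Rightarrow> mso_form" where
  "MDisj \<phi> \<psi> \<equiv> MNeg (MConj (MNeg \<phi>) (MNeg \<psi>))"

abbreviation MIff :: "mso_form \<Rightarrow> mso_form \<Rightarrow> mso_form" where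
  "MIff \<phi> \<psi> \<equiv> MDisj (MConj \<phi> \<psi>) (MConj (MNeg \<phi>) (MNeg \<psi>))"

abbreviation MAll :: "nat \<Rightarrow> mso_form \<Rightarrow> mso_form" where
  "MAll x \<phi> \<equiv> MNeg (MEx x (MNeg \<phi>))"

text \<open>The empty disjunction is a closed formula that is false in every structure, including
  the empty one.\<close>

primrec disj_list :: "mso_form list \<Rightarrow> mso_form" where
  "disj_list [] = MEx 0 (MNeg (MEq 0 0))"
| "disj_list (\<phi> # \<phi>s) = MDisj \<phi> (disj_list \<phi>s)"

lemma disj_list_simps [simp]:
  "mso_sat r v V (disj_list \<phi>s) \<longleftrightarrow> (\<exists>\<phi> \<in> set \<phi>s. mso_sat r v V \<phi>)"
  "mso_fv (disj_list \<phi>s) = (\<Union>\<phi> \<in> set \<phi>s. mso_fv \<phi>)"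
  "mso_set_fv (disj_list \<phi>s) = (\<Union>\<phi> \<in> set \<phi>s. mso_set_fv \<phi>)"
  by (induction \<phi>s) auto

lemma foldr_MExSet_simps [simp]:
  "mso_fv (foldr MExSet ms \<phi>) = mso_fv \<phi>"
  "mso_set_fv (foldr MExSet ms \<phi>) = mso_set_fv \<phi> - set ms"
  by (induction ms) auto

text \<open>A block of set quantifiers amounts to one simultaneous choice \<open>W\<close> of
  subsets for the variables in the list.\<close>

lemma mso_sat_foldr_MExSet:
  "mso_sat r v V (foldr MExSet ms \<phi>) \<longleftrightarrow>
    (\<exists>W. (\<forall>m \<in> set ms. W m \<subseteq> Field r) \<and> mso_sat r v (override_on V W (set ms)) \<phi>)"
proof (induction ms arbitrary: V)
  case Nil
  then show ?case by simp
next
  case (Cons m ms)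
  have "mso_sat r v V (foldr MExSet (m # ms) \<phi>) \<longleftrightarrow>
    (\<exists>A W. A \<subseteq> Field r \<and> (\<forall>m \<in> set ms. W m \<subseteq> Field r) \<and>
       mso_sat r v (override_on (V(m := A)) W (set ms)) \<phi>)"
    by (auto simp: Cons.IH simp del: fun_upd_apply)
  also have "\<dots> \<longleftrightarrow> (\<exists>W. (\<forall>m \<in> set (m # ms). W m \<subseteq> Field r) \<and>
      mso_sat r v (override_on V W (set (m # ms))) \<phi>)"
  proof (intro iffI; elim exE conjE)
    fix A W
    assume *: "A \<subseteq> Field r" "\<forall>m \<in> set ms. W m \<subseteq> Field r"
      "mso_sat r v (override_on (V(m := A)) W (set ms)) \<phi>"
    \<comment> \<open>If \<open>m\<close> is quantified again further inside, the inner choice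
      prevails and \<open>A\<close> is dropped.\<close>
    let ?W = "if m \<in> set ms then W else W(m := A)"
    have "override_on (V(m := A)) W (set ms) = override_on V ?W (set (m # ms))"
      by (intro ext) (auto simp: override_on_def)
    then show "\<exists>W. (\<forall>m \<in> set (m # ms). W m \<subseteq> Field r) \<and>
        mso_sat r v (override_on V W (set (m # ms))) \<phi>"
      using * by (intro exI[of _ ?W]) auto
  next
    fix W
    assume *: "\<forall>m \<in> set (m # ms). W m \<subseteq> Field r"
      "mso_sat r v (override_on V W (set (m # ms))) \<phi>"
    have "override_on (V(m := W m)) W (set ms) = override_on V W (set (m # ms))"
      by (intro ext) (auto simp: override_on_def)
    then show "\<exists>A W. A \<subseteq> Field r \<and> (\<forall>m \<in> set ms. W m \<subseteq> Field r) \<and>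
       mso_sat r v (override_on (V(m := A)) W (set ms)) \<phi>"
      using * by (intro exI[of _ "W m"] exI[of _ W]) auto
  qed
  finally show ?case .
qed

text \<open>In the formulas below, the element variable \<open>1\<close> stands for the height of the node \<open>x\<close>,
  and the element variable \<open>0\<close> is auxiliary.\<close>

definition mso_ht :: "nat \<Rightarrow> nat \<Rightarrow> mso_form" where
  "mso_ht n x =
     MAll 0 (MIff (disj_list (map (\<lambda>i. MMem 0 (x * n + i)) [0..<n])) (MLess 0 1))"

definition mso_node :: "nat \<Rightarrow> nat \<Rightarrow> mso_form" where
  "mso_node n x = MConj (MEx 1 (mso_ht n x))
     (MNeg (MEx 0 (disj_list (map (\<lambda>i. disj_list (map (\<lambda>j.
        MConj (MMem 0 (x * n + i)) (MMem 0 (x * n + j))) [0..<i])) [0..<n]))))"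

definition mso_sub :: "nat \<Rightarrow> nat \<Rightarrow> nat \<Rightarrow> mso_form" where
  "mso_sub n x y = MNeg (MEx 0 (disj_list (map (\<lambda>i.
     MConj (MMem 0 (x * n + i)) (MNeg (MMem 0 (y * n + i)))) [0..<n])))"

definition mso_edge :: "nat \<Rightarrow> nat \<Rightarrow> nat \<Rightarrow> nat \<Rightarrow> mso_form" where
  "mso_edge n i x y = MEx 1 (MConj (mso_ht n x)
     (MNeg (MEx 0 (disj_list (map (\<lambda>j. MNeg (MIff (MMem 0 (y * n + j))
        (if j = i then MDisj (MMem 0 (x * n + j)) (MEq 0 1) else MMem 0 (x * n + j))))
        [0..<n])))))"

text \<open>Terms enter only through \<open>base_var\<close>, so the translation is meant for
  relational formulas. Each node variable owns a block of \<open>n\<close> set variables, and the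
  element variables 0 and 1 can be reused in every atom because they are always bound there.\<close>

primrec mso_of_tree :: "nat \<Rightarrow> tree_form \<Rightarrow> mso_form" where
  "mso_of_tree n (TEq t u) =
     MConj (mso_sub n (base_var t) (base_var u)) (mso_sub n (base_var u) (base_var t))"
| "mso_of_tree n (TSub t u) = mso_sub n (base_var t) (base_var u)"
| "mso_of_tree n (TEdge i t u) = mso_edge n i (base_var t) (base_var u)"
| "mso_of_tree n (TSim t u) =
     MEx 1 (MConj (mso_ht n (base_var t)) (mso_ht n (base_var u)))"
| "mso_of_tree n (TNeg \<phi>) = MNeg (mso_of_tree n \<phi>)"
| "mso_of_tree n (TConj \<phi> \<psi>) = MConj (mso_of_tree n \<phi>) (mso_of_tree n \<psi>)"
| "mso_of_tree n (TEx x \<phi>) =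
     foldr MExSet [x * n..<x * n + n] (MConj (mso_node n x) (mso_of_tree n \<phi>))"

lemma mso_fv_mso_of_tree: "mso_fv (mso_of_tree n \<phi>) = {}"
  by (induction \<phi>)
    (auto simp: mso_sub_def mso_edge_def mso_ht_def mso_node_def split: if_splits)

lemma mem_block_iff:
  fixes m n x :: nat
  assumes "0 < n"
  shows "m \<in> {x * n..<x * n + n} \<longleftrightarrow> m div n = x"
  using div_nat_eqI[of n x m] div_times_less_eq_dividend[of m n] dividend_less_div_times[OF assms, of m]
  by (auto simp: algebra_simps)

text \<open>The block quantified for \<open>x\<close> consists of exactly those set variables whose
  quotient by \<open>n\<close> is \<open>x\<close>.\<close>

lemma mso_set_fv_mso_of_tree:
  assumes "0 < n"
  shows "mso_set_fv (mso_of_tree n \<phi>) \<subseteq> {m. m div n \<in> tree_fv \<phi>}"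
proof (induction \<phi>)
  case (TEx x \<phi>)
  have "mso_set_fv (mso_node n x) \<subseteq> {x * n..<x * n + n}"
    by (auto simp: mso_node_def mso_ht_def)
  then have "mso_set_fv (mso_of_tree n (TEx x \<phi>)) \<subseteq>
      mso_set_fv (mso_of_tree n \<phi>) - {x * n..<x * n + n}"
    by auto
  also have "\<dots> \<subseteq> {m. m div n \<in> tree_fv \<phi>} - {x * n..<x * n + n}"
    using TEx.IH by blast
  also have "\<dots> \<subseteq> {m. m div n \<in> tree_fv (TEx x \<phi>)}"
    using mem_block_iff[OF assms] by fastforce
  finally show ?case .
qed (use assms in \<open>auto simp: mso_sub_def mso_edge_def mso_ht_def tvars_base_var split: if_splits\<close>)

section \<open>Meaning of the MSO formulas for height, node, inclusion and edge\<close>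

lemma mso_sat_mso_ht:
  assumes V: "\<And>i. i < n \<Longrightarrow> V (x * n + i) \<subseteq> Field r"
  shows "mso_sat r v V (mso_ht n x) \<longleftrightarrow> (\<Union>i<n. V (x * n + i)) = underS r (v 1)"
proof -
  \<comment> \<open>The formula compares the two sets only at elements of \<open>Field r\<close>;
    equality follows because both are contained in \<open>Field r\<close>.\<close>
  have "underS r (v 1) \<subseteq> Field r" by (auto simp: underS_def Field_def)
  moreover have "(\<Union>i<n. V (x * n + i)) \<subseteq> Field r" using V by auto
  moreover have "mso_sat r v V (mso_ht n x) \<longleftrightarrow>
      (\<forall>a \<in> Field r. a \<in> (\<Union>i<n. V (x * n + i)) \<longleftrightarrow> a \<in> underS r (v 1))"
    by (auto simp: mso_ht_def underS_def atLeast0LessThan)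
  ultimately show ?thesis by blast
qed

lemma code_env_simp: "i < n \<Longrightarrow> code_env n s (x * n + i) = code (s x) i"
  by (simp add: code_env_def)

lemma code_subset_Field:
  assumes "s \<in> nodes n r"
  shows "code s i \<subseteq> Field r"
  using assms by (fastforce simp: code_def nodes_def underS_def Field_def)

lemma UN_code: "s \<in> nodes n r \<Longrightarrow> (\<Union>i<n. code s i) = dom s"
  by (auto simp: code_def dest: node_val_less)

lemma mso_sat_mso_ht_code:
  assumes "Well_order r" "s x \<in> nodes n r" "v 1 \<in> Field r"
  shows "mso_sat r v (code_env n s) (mso_ht n x) \<longleftrightarrow> v 1 = ht r (s x)"
proof -
  have "mso_sat r v (code_env n s) (mso_ht n x) \<longleftrightarrow> dom (s x) = underS r (v 1)"
    using UN_code[OF assms(2)] code_subset_Field[OF assms(2)]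
    by (subst mso_sat_mso_ht) (simp_all add: code_env_simp)
  also have "\<dots> \<longleftrightarrow> v 1 = ht r (s x)"
    using assms ht_eq node_ht by metis
  finally show ?thesis .
qed

text \<open>A tuple of sets is the code of a map exactly when the sets are pairwise disjoint, and
  this map is a node exactly when their union is \<open>underS r b\<close> for some \<open>b\<close>
  in the ordinal.\<close>

lemma mso_sat_mso_node:
  assumes V: "\<And>i. i < n \<Longrightarrow> V (x * n + i) \<subseteq> Field r"
  shows "mso_sat r v V (mso_node n x) \<longleftrightarrow> (\<exists>s \<in> nodes n r. \<forall>i<n. V (x * n + i) = code s i)"
proof -
  have "mso_sat r v V (mso_node n x) \<longleftrightarrow>
      (\<exists>b \<in> Field r. mso_sat r (v(1 := b)) V (mso_ht n x)) \<and>
      \<not> (\<exists>a \<in> Field r. \<exists>i \<in> {0..<n}. \<exists>j \<in> {0..<i}. a \<in> V (x * n + i) \<and> a \<in> V (x * n + j))"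
    by (simp add: mso_node_def)
  also have "\<dots> \<longleftrightarrow> (\<exists>b \<in> Field r. (\<Union>i<n. V (x * n + i)) = underS r b) \<and>
      (\<forall>i<n. \<forall>j<i. V (x * n + i) \<inter> V (x * n + j) = {})" (is "_ \<longleftrightarrow> ?ht \<and> ?disj")
  proof (rule arg_cong2[where f = "(\<and>)"])
    have "mso_sat r (v(1 := b)) V (mso_ht n x) \<longleftrightarrow> (\<Union>i<n. V (x * n + i)) = underS r b" for b
      using V by (subst mso_sat_mso_ht) simp_all
    then show "(\<exists>b \<in> Field r. mso_sat r (v(1 := b)) V (mso_ht n x)) \<longleftrightarrow> ?ht" by simp
    show "(\<not> (\<exists>a \<in> Field r. \<exists>i \<in> {0..<n}. \<exists>j \<in> {0..<i}.
        a \<in> V (x * n + i) \<and> a \<in> V (x * n + j))) \<longleftrightarrow> ?disj"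
      using V by (fastforce simp: disjoint_iff)
  qed
  also have "\<dots> \<longleftrightarrow> (\<exists>s \<in> nodes n r. \<forall>i<n. V (x * n + i) = code s i)"
  proof
    assume *: "?ht \<and> ?disj"
    \<comment> \<open>The entry at \<open>a\<close> is the index of a set containing
      \<open>a\<close>; disjointness makes this index unique.\<close>
    define s where "s a = (if \<exists>i<n. a \<in> V (x * n + i)
      then Some (SOME i. i < n \<and> a \<in> V (x * n + i)) else None)" for a
    have s: "s a = Some i \<longleftrightarrow> i < n \<and> a \<in> V (x * n + i)" for a i
    proof -
      have "j = i" if "i < n" "j < n" "a \<in> V (x * n + i)" "a \<in> V (x * n + j)" for i j
        using * that by (metis IntI empty_iff linorder_neqE_nat)
      moreover have "(SOME i. i < n \<and> a \<in> V (x * n + i)) < n \<and>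
          a \<in> V (x * n + (SOME i. i < n \<and> a \<in> V (x * n + i)))" if "\<exists>i<n. a \<in> V (x * n + i)"
        using that by (rule someI_ex)
      ultimately show ?thesis by (auto simp: s_def)
    qed
    have "dom s = (\<Union>i<n. V (x * n + i))" using s by auto
    then have "s \<in> nodes n r" using * s by (auto simp: nodes_def ran_def)
    moreover have "\<forall>i<n. V (x * n + i) = code s i" using s by (auto simp: code_def)
    ultimately show "\<exists>s \<in> nodes n r. \<forall>i<n. V (x * n + i) = code s i" by blast
  next
    assume "\<exists>s \<in> nodes n r. \<forall>i<n. V (x * n + i) = code s i"
    then obtain s where s: "s \<in> nodes n r" "\<forall>i<n. V (x * n + i) = code s i" by blast
    then have "(\<Union>i<n. V (x * n + i)) = dom s" using UN_code[OF s(1)] by simp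
    then have ?ht using s(1) by (auto simp: nodes_def)
    moreover have ?disj using s(2) by (auto simp: code_def)
    ultimately show "?ht \<and> ?disj" ..
  qed
  finally show ?thesis .
qed

text \<open>All entries of the node \<open>s x\<close> are below \<open>n\<close>, so its
  \<open>n\<close> code sets together determine its whole graph.\<close>

lemma mso_sat_mso_sub:
  assumes "s x \<in> nodes n r"
  shows "mso_sat r v (code_env n s) (mso_sub n x y) \<longleftrightarrow> s x \<subseteq>\<^sub>m s y"
proof -
  have "mso_sat r v (code_env n s) (mso_sub n x y) \<longleftrightarrow> (\<forall>i<n. code (s x) i \<subseteq> code (s y) i)"
    using code_subset_Field[OF assms]
    by (auto simp: mso_sub_def code_env_simp atLeast0LessThan)
  also have "\<dots> \<longleftrightarrow> s x \<subseteq>\<^sub>m s y"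
  proof
    assume le: "\<forall>i<n. code (s x) i \<subseteq> code (s y) i"
    show "s x \<subseteq>\<^sub>m s y"
      unfolding map_le_def
    proof
      fix a assume "a \<in> dom (s x)"
      then obtain i where "s x a = Some i" by blast
      moreover have "i < n" using assms calculation by (rule node_val_less)
      ultimately show "s x a = s y a" using le[rule_format, of i] by (simp add: code_def subset_iff)
    qed
  qed (force simp: code_def map_le_def)
  finally show ?thesis .
qed

text \<open>Extending a node by \<open>i\<close> adds its height to the code set of index
  \<open>i\<close> and leaves the others alone. Since \<open>s y\<close> is already a node, equality
  with the extended map also settles that the successor is defined.\<close>

lemma mso_sat_mso_edge:
  assumes wo: "Well_order r" and x: "s x \<in> nodes n r" and y: "s y \<in> nodes n r" and i: "i < n"
  shows "mso_sat r v (code_env n s) (mso_edge n i x y) \<longleftrightarrow> succ_node n r i (s x) = Some (s y)"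
proof -
  let ?h = "ht r (s x)"
  let ?t = "(s x)(?h \<mapsto> i)"
  have h: "?h \<in> Field r" "s x ?h = None"
    using node_ht[OF wo x] by (auto simp: underS_def)
  have code_t: "code ?t j = code (s x) j \<union> (if j = i then {?h} else {})" for j
    using h(2) by (auto simp: code_def)
  have "mso_sat r v (code_env n s) (mso_edge n i x y) \<longleftrightarrow>
      (\<forall>j<n. \<forall>a \<in> Field r. a \<in> code (s y) j \<longleftrightarrow> a \<in> code ?t j)"
  proof -
    \<comment> \<open>The height formula pins the element variable 1 to the height of
      \<open>s x\<close>, so its quantifier is a one-point quantifier.\<close>
    have "(\<exists>b \<in> Field r. b = ?h \<and> P b) \<longleftrightarrow> P ?h" for P using h(1) by blast
    then show ?thesis
      using x by (simp add: mso_edge_def code_t mso_sat_mso_ht_code[OF wo] code_env_simp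
          atLeast0LessThan) blast
  qed
  also have "\<dots> \<longleftrightarrow> (\<forall>j<n. code (s y) j = code ?t j)"
  proof -
    have "code (s y) j \<subseteq> Field r" "code ?t j \<subseteq> Field r" for j
      using code_subset_Field[OF x, of j] code_subset_Field[OF y] h(1) by (simp_all add: code_t)
    then show ?thesis by blast
  qed
  also have "\<dots> \<longleftrightarrow> s y = ?t"
  proof
    assume *: "\<forall>j<n. code (s y) j = code ?t j"
    have "s y a = Some j \<longleftrightarrow> ?t a = Some j" for a j
    proof (cases "j < n")
      case True
      with * show ?thesis by (auto simp: code_def set_eq_iff)
    next
      \<comment> \<open>Neither map has an entry outside the alphabet; for the extended map this
        uses \<open>i < n\<close>.\<close>
      case False
      then show ?thesis using i node_val_less[OF x] node_val_less[OF y] by auto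
    qed
    then show "s y = ?t" by (metis ext option.exhaust)
  qed simp
  also have "\<dots> \<longleftrightarrow> succ_node n r i (s x) = Some (s y)"
    using y by (auto simp: succ_node_eq_Some_iff)
  finally show ?thesis .
qed

section \<open>Node quantifiers as blocks of set quantifiers\<close>

lemma override_code_env:
  assumes "0 < n" "\<And>i. i < n \<Longrightarrow> W (x * n + i) = code t i"
  shows "override_on (code_env n s) W {x * n..<x * n + n} = code_env n (s(x := t))"
proof
  fix m
  show "override_on (code_env n s) W {x * n..<x * n + n} m = code_env n (s(x := t)) m"
  proof (cases "m \<in> {x * n..<x * n + n}")
    case True
    then obtain i where "m = x * n + i" "i < n"
      by (metis add_less_cancel_left atLeastLessThan_iff le_Suc_ex)
    then show ?thesis using assms by (simp add: code_env_simp)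
  next
    case False
    then have "m div n \<noteq> x" using mem_block_iff[OF assms(1), of m x] by blast
    then have "code_env n (s(x := t)) m = code_env n s m" by (simp add: code_env_def)
    then show ?thesis unfolding override_on_apply_notin[OF False] ..
  qed
qed

lemma mso_sat_Ex_node:
  assumes n: "0 < n"
  shows "mso_sat r v (code_env n s) (foldr MExSet [x * n..<x * n + n] (MConj (mso_node n x) \<phi>))
    \<longleftrightarrow> (\<exists>t \<in> nodes n r. mso_sat r v (code_env n (s(x := t))) \<phi>)"
    (is "?L \<longleftrightarrow> ?R")
proof
  assume ?L
  then obtain W where W: "\<forall>m \<in> {x * n..<x * n + n}. W m \<subseteq> Field r"
      "mso_sat r v (override_on (code_env n s) W {x * n..<x * n + n}) (mso_node n x)"
      "mso_sat r v (override_on (code_env n s) W {x * n..<x * n + n}) \<phi>"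
    by (auto simp: mso_sat_foldr_MExSet)
  have "\<exists>t \<in> nodes n r. \<forall>i<n.
      override_on (code_env n s) W {x * n..<x * n + n} (x * n + i) = code t i"
    using W(1,2) by (intro mso_sat_mso_node[THEN iffD1]) (auto simp: override_on_def)
  then obtain t where t: "t \<in> nodes n r" "\<forall>i<n. W (x * n + i) = code t i"
    by (auto simp: override_on_def)
  then show ?R using W(3) override_code_env[OF n, of W x t s] by auto
next
  assume ?R
  then obtain t where t: "t \<in> nodes n r" "mso_sat r v (code_env n (s(x := t))) \<phi>" by blast
  \<comment> \<open>The whole updated environment serves as the choice of sets; only its values on
    the block of \<open>x\<close> are used.\<close>
  let ?V = "code_env n (s(x := t))"
  have "?V m \<subseteq> Field r" if "m \<in> {x * n..<x * n + n}" for m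
    using that mem_block_iff[OF n, of m x] code_subset_Field[OF t(1)] by (simp add: code_env_def)
  moreover have "mso_sat r v ?V (mso_node n x)"
    using t(1) code_subset_Field[OF t(1)]
    by (intro mso_sat_mso_node[THEN iffD2]) (auto simp: code_env_simp)
  moreover have "override_on (code_env n s) ?V {x * n..<x * n + n} = ?V"
    using n by (intro override_code_env) (simp_all add: code_env_simp)
  ultimately show ?L
    using t(2) unfolding mso_sat_foldr_MExSet by (intro exI[of _ ?V]) simp
qed

lemma is_varE: "is_var t \<Longrightarrow> t = TVar (base_var t)"
  by (cases t) auto

text \<open>The assignment \<open>v\<close> can stay fixed throughout the induction, because no
  subformula is translated in the scope of an element quantifier.\<close>

lemma mso_sat_mso_of_tree:
  assumes wo: "Well_order r" and n: "0 < n"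
  shows "relational \<phi> \<Longrightarrow> form_over n \<phi> \<Longrightarrow> \<forall>x \<in> tree_fv \<phi>. s x \<in> nodes n r \<Longrightarrow>
    mso_sat r v (code_env n s) (mso_of_tree n \<phi>) \<longleftrightarrow> tree_sat n r s \<phi>"
proof (induction \<phi> arbitrary: s)
  case (TEq t u)
  then obtain x y where "t = TVar x" "u = TVar y" by (auto dest: is_varE)
  then show ?case using TEq by (auto simp: mso_sat_mso_sub intro: map_le_antisym)
next
  case (TSub t u)
  then obtain x y where "t = TVar x" "u = TVar y" by (auto dest: is_varE)
  then show ?case using TSub by (auto simp: mso_sat_mso_sub)
next
  case (TEdge i t u)
  then obtain x y where "t = TVar x" "u = TVar y" by (auto dest: is_varE)
  then show ?case using TEdge by (auto simp: mso_sat_mso_edge[OF wo])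
next
  case (TSim t u)
  then obtain x y where "t = TVar x" "u = TVar y" by (auto dest: is_varE)
  then show ?case using TSim node_ht(1)[OF wo] by (auto simp: mso_sat_mso_ht_code[OF wo])
next
  case (TEx x \<phi>)
  then show ?case by (simp add: mso_sat_Ex_node[OF n])
qed simp_all


section \<open>From monadic second-order logic to the tree\<close>

lemma Field_ord_succ: "Field (ord_succ r) = insert None (Some ` Field r)"
  by (auto simp: ord_succ_def Field_def)

lemma Some_in_ord_succ_iff: "(Some a, Some b) \<in> ord_succ r \<longleftrightarrow> (a, b) \<in> r"
  by (auto simp: ord_succ_def)

lemma Well_order_ord_succ:
  assumes "Well_order r"
  shows "Well_order (ord_succ r)"
proof -
  have r: "refl_on (Field r) r" "trans r" "antisym r" "total_on (Field r) r" "wf (r - Id)"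
    using assms
    by (auto simp: well_order_on_def linear_order_on_def partial_order_on_def preorder_on_def)
  have "refl_on (Field (ord_succ r)) (ord_succ r)"
    using r(1) unfolding Field_ord_succ by (auto simp: refl_on_def ord_succ_def)
  moreover have "trans (ord_succ r)"
  proof (rule transI)
    fix x y z assume *: "(x, y) \<in> ord_succ r" "(y, z) \<in> ord_succ r"
    show "(x, z) \<in> ord_succ r"
    proof (cases z)
      case None
      then show ?thesis using *(1) by (cases x) (auto simp: ord_succ_def FieldI1)
    next
      case (Some c)
      then obtain b where "y = Some b" "(b, c) \<in> r" using *(2) by (auto simp: ord_succ_def)
      moreover from this(1) obtain a where "x = Some a" "(a, b) \<in> r"
        using *(1) by (auto simp: ord_succ_def)
      ultimately show ?thesis
        using Some transD[OF r(2), of a b c] by (simp add: Some_in_ord_succ_iff)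
    qed
  qed
  moreover have "antisym (ord_succ r)"
    using r(3) by (auto simp: antisym_def ord_succ_def)
  moreover have "total_on (Field (ord_succ r)) (ord_succ r)"
    using r(4) unfolding Field_ord_succ by (auto simp: total_on_def ord_succ_def)
  moreover have "wf (ord_succ r - Id)"
    unfolding wf_eq_minimal
  proof (intro allI impI)
    fix Q :: "'a option set" and q
    assume "q \<in> Q"
    show "\<exists>z \<in> Q. \<forall>y. (y, z) \<in> ord_succ r - Id \<longrightarrow> y \<notin> Q"
    \<comment> \<open>Since \<open>None\<close> is the greatest element, it can be minimal in
      \<open>Q\<close> only if \<open>Q\<close> contains nothing else.\<close>
    proof (cases "\<exists>a. Some a \<in> Q")
      case True
      then obtain a where "a \<in> {a. Some a \<in> Q}" by blast
      with r(5) obtain z where "Some z \<in> Q" "\<And>y. (y, z) \<in> r - Id \<Longrightarrow> Some y \<notin> Q"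
        by (rule wfE_min) blast
      then show ?thesis by (intro bexI[of _ "Some z"]) (auto simp: ord_succ_def)
    next
      case False
      then have "q = None" using \<open>q \<in> Q\<close> by (cases q) auto
      then show ?thesis using False \<open>q \<in> Q\<close> by (intro bexI[of _ None]) (auto simp: ord_succ_def)
    qed
  qed
  moreover have "ord_succ r \<subseteq> Field (ord_succ r) \<times> Field (ord_succ r)"
    by (auto intro: FieldI1 FieldI2)
  ultimately show ?thesis
    unfolding well_order_on_def linear_order_on_def partial_order_on_def preorder_on_def
    by (intro conjI)
qed

lemma underS_ord_succ_None: "underS (ord_succ r) None = Some ` Field r"
  by (auto simp: underS_def ord_succ_def)

lemma underS_ord_succ_subset: "underS (ord_succ r) b \<subseteq> Some ` Field r"
  by (auto simp: underS_def ord_succ_def intro: FieldI1)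

lemma char_node_eq_Some_iff:
  "char_node r A p = Some i \<longleftrightarrow> (\<exists>c \<in> Field r. p = Some c \<and> i = (if c \<in> A then 1 else 0))"
  by (cases p) (auto simp: char_node_def)

lemma char_node_in_nodes:
  assumes "2 \<le> n"
  shows "char_node r A \<in> nodes n (ord_succ r)"
proof -
  have "dom (char_node r A) = underS (ord_succ r) None"
    unfolding underS_ord_succ_None dom_def by (auto simp only: char_node_eq_Some_iff not_None_eq)
  moreover have "ran (char_node r A) \<subseteq> {..<n}"
    using assms by (auto simp: ran_def char_node_eq_Some_iff)
  ultimately show ?thesis unfolding nodes_def Field_ord_succ by blast
qed

lemma code_char_node:
  assumes "A \<subseteq> Field r"
  shows "code (char_node r A) 1 = Some ` A"
  using assms by (auto simp: code_def char_node_eq_Some_iff split: if_splits)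

text \<open>The greatest element \<open>None\<close> is never strictly below anything, so it is not
  a position of any node. Hence every node, of whatever height, represents a genuine subset of
  \<alpha>.\<close>

lemma code_ord_succ_subset:
  assumes "s \<in> nodes n (ord_succ r)"
  shows "code s i \<subseteq> Some ` Field r"
proof -
  have "code s i \<subseteq> dom s" by (auto simp: code_def)
  then show ?thesis using assms underS_ord_succ_subset by (fastforce simp: nodes_def)
qed

text \<open>The initial segment \<open>u\<close> of \<open>y\<close> represents a position at which \<open>y\<close> has the entry \<open>1\<close>;
  the variable \<open>N\<close> is fresh.\<close>

definition one_at :: "nat \<Rightarrow> nat \<Rightarrow> nat \<Rightarrow> tree_form" where
  "one_at N u y = TEx N (TConj (TEdge 1 (TVar u) (TVar N)) (TSub (TVar N) (TVar y)))"

text \<open>One formula serves two atoms: a singleton meets another singleton iff they are equal,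
  and it meets a set iff its element is a member.\<close>

definition tree_overlap :: "nat \<Rightarrow> nat \<Rightarrow> nat \<Rightarrow> tree_form" where
  "tree_overlap N y z = TEx N (TEx (N + 1) (TConj (TSim (TVar N) (TVar (N + 1)))
     (TConj (one_at (N + 2) N y) (one_at (N + 2) (N + 1) z))))"

text \<open>The order on heights is recovered from inclusion and \<open>~\<close>: a position
  precedes another iff the initial segment marking the second has a proper initial segment of the
  height of the first, here the variable \<open>N + 2\<close>.\<close>

definition tree_less :: "nat \<Rightarrow> nat \<Rightarrow> nat \<Rightarrow> tree_form" where
  "tree_less N y z = TEx N (TEx (N + 1) (TEx (N + 2) (TConj
     (TConj (one_at (N + 3) N y) (one_at (N + 3) (N + 1) z))
     (TConj (TSim (TVar (N + 2)) (TVar N)) (TConj (TSub (TVar (N + 2)) (TVar (N + 1)))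
       (TNeg (TSim (TVar (N + 2)) (TVar (N + 1)))))))))"

definition tree_single :: "nat \<Rightarrow> nat \<Rightarrow> tree_form" where
  "tree_single N y = TEx N (TConj (one_at (N + 2) N y)
     (TNeg (TEx (N + 1) (TConj (one_at (N + 2) (N + 1) y)
       (TNeg (TSim (TVar N) (TVar (N + 1))))))))"

primrec tree_of_mso :: "mso_form \<Rightarrow> (nat \<Rightarrow> nat) \<Rightarrow> (nat \<Rightarrow> nat) \<Rightarrow> nat \<Rightarrow> tree_form" where
  "tree_of_mso (MEq x y) f g N = tree_overlap N (f x) (f y)"
| "tree_of_mso (MLess x y) f g N = tree_less N (f x) (f y)"
| "tree_of_mso (MMem x X) f g N = tree_overlap N (f x) (g X)"
| "tree_of_mso (MNeg \<phi>) f g N = TNeg (tree_of_mso \<phi> f g N)"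
| "tree_of_mso (MConj \<phi> \<psi>) f g N = TConj (tree_of_mso \<phi> f g N) (tree_of_mso \<psi> f g N)"
| "tree_of_mso (MEx x \<phi>) f g N =
     TEx N (TConj (tree_single (Suc N) N) (tree_of_mso \<phi> (f(x := N)) g (Suc N)))"
| "tree_of_mso (MExSet X \<phi>) f g N = TEx N (tree_of_mso \<phi> f (g(X := N)) (Suc N))"

lemmas tree_atom_defs = one_at_def tree_overlap_def tree_less_def tree_single_def

lemma form_over_tree_of_mso: "2 \<le> n \<Longrightarrow> form_over n (tree_of_mso \<psi> f g N)"
  by (induction \<psi> arbitrary: f g N) (auto simp: tree_atom_defs)

lemma relational_tree_of_mso: "relational (tree_of_mso \<psi> f g N)"
  by (induction \<psi> arbitrary: f g N) (auto simp: tree_atom_defs)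

lemma fun_upd_image_subset: "(f(x := y)) ` A \<subseteq> insert y (f ` (A - {x}))"
proof (rule image_subsetI)
  fix a assume "a \<in> A"
  then show "(f(x := y)) a \<in> insert y (f ` (A - {x}))" by (cases "a = x") simp_all
qed

text \<open>No freshness of \<open>N\<close> is assumed: a capture could only remove free variables,
  which is compatible with an inclusion.\<close>

lemma tree_fv_tree_of_mso:
  "tree_fv (tree_of_mso \<psi> f g N) \<subseteq> f ` mso_fv \<psi> \<union> g ` mso_set_fv \<psi>"
proof (induction \<psi> arbitrary: f g N)
  case (MConj \<psi>\<^sub>1 \<psi>\<^sub>2)
  then show ?case
    unfolding tree_of_mso.simps tree_fv.simps mso_fv.simps mso_set_fv.simps image_Un by blast
next
  case (MEx x \<psi>)
  have "tree_fv (tree_of_mso \<psi> (f(x := N)) g (Suc N)) \<subseteq>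
      insert N (f ` (mso_fv \<psi> - {x})) \<union> g ` mso_set_fv \<psi>"
    by (rule order_trans[OF MEx]) (intro Un_mono fun_upd_image_subset order_refl)
  moreover have "tree_fv (tree_single (Suc N) N) = {N}" by (auto simp: tree_atom_defs)
  ultimately show ?case
    unfolding tree_of_mso.simps tree_fv.simps mso_fv.simps mso_set_fv.simps
    by (simp only:) fast
next
  case (MExSet X \<psi>)
  have "tree_fv (tree_of_mso \<psi> f (g(X := N)) (Suc N)) \<subseteq>
      f ` mso_fv \<psi> \<union> insert N (g ` (mso_set_fv \<psi> - {X}))"
    by (rule order_trans[OF MExSet]) (intro Un_mono fun_upd_image_subset order_refl)
  then show ?case
    unfolding tree_of_mso.simps tree_fv.simps mso_fv.simps mso_set_fv.simps by fast
qed (auto simp: tree_atom_defs)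

section \<open>Meaning of the atomic translations, over an arbitrary well-order\<close>

context
  fixes r :: "'a rel" and n :: nat
  assumes wo: "Well_order r"
begin

lemma tree_sat_one_at:
  assumes "u < N" "y < N" "e u \<in> nodes n r" "e y \<in> nodes n r"
  shows "tree_sat n r e (one_at N u y) \<longleftrightarrow> e u \<subseteq>\<^sub>m e y \<and> e y (ht r (e u)) = Some 1"
  using assms succ_node_below_iff[OF wo, of "e u" n "e y" 1] by (auto simp: one_at_def)

text \<open>Taking heights sends the proper initial segments of \<open>y\<close> onto the positions
  of \<open>y\<close>, with restriction of \<open>y\<close> supplying the preimages. A quantifier
  over such segments that depends only on heights is thus a quantifier over positions.\<close>

lemma ex_prefix_iff:
  assumes "y \<in> nodes n r"
  shows "(\<exists>u \<in> nodes n r. u \<subseteq>\<^sub>m y \<and> y (ht r u) = Some i \<and> P (ht r u)) \<longleftrightarrow>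
    (\<exists>c \<in> code y i. P c)"
proof
  assume "\<exists>c \<in> code y i. P c"
  then obtain c where c: "y c = Some i" "P c" by (auto simp: code_def)
  then have "c \<in> dom y" by blast
  from restrict_node[OF wo assms this] c
  show "\<exists>u \<in> nodes n r. u \<subseteq>\<^sub>m y \<and> y (ht r u) = Some i \<and> P (ht r u)"
    by (intro bexI[of _ "y |` underS r c"]) simp_all
qed (auto simp: code_def)

lemma ex_prefixes_iff:
  assumes "y \<in> nodes n r" "z \<in> nodes n r"
  shows "(\<exists>u \<in> nodes n r. u \<subseteq>\<^sub>m y \<and> y (ht r u) = Some i \<and>
      (\<exists>u' \<in> nodes n r. u' \<subseteq>\<^sub>m z \<and> z (ht r u') = Some j \<and> Q (ht r u) (ht r u'))) \<longleftrightarrow>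
    (\<exists>a \<in> code y i. \<exists>b \<in> code z j. Q a b)"
proof -
  have "(\<exists>u' \<in> nodes n r. u' \<subseteq>\<^sub>m z \<and> z (ht r u') = Some j \<and> Q a (ht r u')) \<longleftrightarrow>
      (\<exists>b \<in> code z j. Q a b)" for a
    by (rule ex_prefix_iff[OF assms(2)])
  then show ?thesis
    by (simp only: ex_prefix_iff[OF assms(1), where P = "\<lambda>a. \<exists>b \<in> code z j. Q a b"])
qed

lemma tree_sat_tree_overlap:
  assumes "y < N" "z < N" "e y \<in> nodes n r" "e z \<in> nodes n r"
  shows "tree_sat n r e (tree_overlap N y z) \<longleftrightarrow> code (e y) 1 \<inter> code (e z) 1 \<noteq> {}"
proof -
  have "tree_sat n r e (tree_overlap N y z) \<longleftrightarrow>
    (\<exists>u \<in> nodes n r. u \<subseteq>\<^sub>m e y \<and> e y (ht r u) = Some 1 \<and>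
      (\<exists>u' \<in> nodes n r. u' \<subseteq>\<^sub>m e z \<and> e z (ht r u') = Some 1 \<and> ht r u = ht r u'))"
    using assms by (simp add: tree_overlap_def tree_sat_one_at) blast
  also have "\<dots> \<longleftrightarrow> (\<exists>a \<in> code (e y) 1. \<exists>b \<in> code (e z) 1. a = b)"
    using assms(3,4) by (rule ex_prefixes_iff)
  finally show ?thesis by blast
qed

lemma ex_prefix_of_height_iff:
  assumes "y \<in> nodes n r"
  shows "(\<exists>w \<in> nodes n r. ht r w = c \<and> w \<subseteq>\<^sub>m y \<and> ht r w \<noteq> ht r y) \<longleftrightarrow> c \<in> underS r (ht r y)"
proof
  assume "\<exists>w \<in> nodes n r. ht r w = c \<and> w \<subseteq>\<^sub>m y \<and> ht r w \<noteq> ht r y"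
  then obtain w where w: "w \<in> nodes n r" "ht r w = c" "w \<subseteq>\<^sub>m y" "c \<noteq> ht r y" by blast
  have "underS r c \<subseteq> underS r (ht r y)"
    using map_le_implies_dom_le[OF w(3)] node_ht(2)[OF wo] w(1,2) assms by metis
  \<comment> \<open>Otherwise the height of \<open>y\<close> would lie strictly below
    itself.\<close>
  then have "ht r y \<notin> underS r c" by (auto simp: underS_def)
  moreover have "c \<in> Field r" "ht r y \<in> Field r" using node_ht(1)[OF wo] w(1,2) assms by auto
  ultimately show "c \<in> underS r (ht r y)"
    using wo w(4) by (auto simp: underS_def well_order_on_def linear_order_on_def total_on_def)
next
  assume c: "c \<in> underS r (ht r y)"
  then have "c \<in> dom y" "c \<noteq> ht r y" using node_ht(2)[OF wo assms] by (auto simp: underS_def)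
  then show "\<exists>w \<in> nodes n r. ht r w = c \<and> w \<subseteq>\<^sub>m y \<and> ht r w \<noteq> ht r y"
    using restrict_node[OF wo assms, of c] by (intro bexI[of _ "y |` underS r c"]) simp_all
qed

lemma tree_sat_tree_less:
  assumes "y < N" "z < N" "e y \<in> nodes n r" "e z \<in> nodes n r"
  shows "tree_sat n r e (tree_less N y z) \<longleftrightarrow>
    (\<exists>a \<in> code (e y) 1. \<exists>b \<in> code (e z) 1. a \<in> underS r b)"
proof -
  have "tree_sat n r e (tree_less N y z) \<longleftrightarrow>
    (\<exists>u \<in> nodes n r. u \<subseteq>\<^sub>m e y \<and> e y (ht r u) = Some 1 \<and>
      (\<exists>u' \<in> nodes n r. u' \<subseteq>\<^sub>m e z \<and> e z (ht r u') = Some 1 \<and>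
        (\<exists>w \<in> nodes n r. ht r w = ht r u \<and> w \<subseteq>\<^sub>m u' \<and> ht r w \<noteq> ht r u')))"
    using assms by (simp add: tree_less_def tree_sat_one_at)
  also have "\<dots> \<longleftrightarrow>
    (\<exists>u \<in> nodes n r. u \<subseteq>\<^sub>m e y \<and> e y (ht r u) = Some 1 \<and>
      (\<exists>u' \<in> nodes n r. u' \<subseteq>\<^sub>m e z \<and> e z (ht r u') = Some 1 \<and> ht r u \<in> underS r (ht r u')))"
    by (simp add: ex_prefix_of_height_iff cong: bex_cong)
  also have "\<dots> \<longleftrightarrow> (\<exists>a \<in> code (e y) 1. \<exists>b \<in> code (e z) 1. a \<in> underS r b)"
    using assms(3,4) by (rule ex_prefixes_iff)
  finally show ?thesis .
qed

lemma tree_sat_tree_single: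
  assumes "y < N" "e y \<in> nodes n r"
  shows "tree_sat n r e (tree_single N y) \<longleftrightarrow> (\<exists>c. code (e y) 1 = {c})"
proof -
  have "tree_sat n r e (tree_single N y) \<longleftrightarrow>
    (\<exists>u \<in> nodes n r. u \<subseteq>\<^sub>m e y \<and> e y (ht r u) = Some 1 \<and>
      \<not> (\<exists>u' \<in> nodes n r. u' \<subseteq>\<^sub>m e y \<and> e y (ht r u') = Some 1 \<and> ht r u \<noteq> ht r u'))"
    using assms by (simp add: tree_single_def tree_sat_one_at)
  also have "\<dots> \<longleftrightarrow> (\<exists>a \<in> code (e y) 1. \<not> (\<exists>b \<in> code (e y) 1. a \<noteq> b))"
  proof -
    have "(\<exists>u' \<in> nodes n r. u' \<subseteq>\<^sub>m e y \<and> e y (ht r u') = Some 1 \<and> a \<noteq> ht r u') \<longleftrightarrow>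
        (\<exists>b \<in> code (e y) 1. a \<noteq> b)" for a
      by (rule ex_prefix_iff[OF assms(2)])
    then show ?thesis
      by (simp only: ex_prefix_iff[OF assms(2), where P = "\<lambda>a. \<not> (\<exists>b \<in> code (e y) 1. a \<noteq> b)"])
  qed
  also have "\<dots> \<longleftrightarrow> (\<exists>c. code (e y) 1 = {c})" by auto
  finally show ?thesis .
qed

end

text \<open>The bounds by \<open>N\<close> ensure that assigning a node to variable \<open>N\<close>
  disturbs none of the nodes already standing for free variables.\<close>

lemma tree_sat_tree_of_mso:
  assumes wo: "Well_order r" and n: "2 \<le> n"
  shows "\<forall>x \<in> mso_fv \<psi>. f x < N \<and> e (f x) \<in> nodes n (ord_succ r) \<and> code (e (f x)) 1 = {Some (v x)} \<Longrightarrow>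
    \<forall>X \<in> mso_set_fv \<psi>. g X < N \<and> e (g X) \<in> nodes n (ord_succ r) \<and> code (e (g X)) 1 = Some ` A X \<Longrightarrow>
    tree_sat n (ord_succ r) e (tree_of_mso \<psi> f g N) \<longleftrightarrow> mso_sat r v A \<psi>"
proof (induction \<psi> arbitrary: f g N e v A)
  case (MEq x y)
  then show ?case by (auto simp: tree_sat_tree_overlap[OF Well_order_ord_succ[OF wo]])
next
  case (MLess x y)
  then show ?case
    by (auto simp: tree_sat_tree_less[OF Well_order_ord_succ[OF wo]] underS_def
        Some_in_ord_succ_iff)
next
  case (MMem x X)
  then show ?case by (auto simp: tree_sat_tree_overlap[OF Well_order_ord_succ[OF wo]])
next
  case (MConj \<psi>\<^sub>1 \<psi>\<^sub>2)
  have "tree_sat n (ord_succ r) e (tree_of_mso \<psi>\<^sub>1 f g N) \<longleftrightarrow> mso_sat r v A \<psi>\<^sub>1"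
    using MConj.prems by (intro MConj.IH(1)) simp_all
  moreover have "tree_sat n (ord_succ r) e (tree_of_mso \<psi>\<^sub>2 f g N) \<longleftrightarrow> mso_sat r v A \<psi>\<^sub>2"
    using MConj.prems by (intro MConj.IH(2)) simp_all
  ultimately show ?case by simp
next
  case (MEx x \<psi>)
  let ?R = "ord_succ r"
  have IH: "tree_sat n ?R (e(N := s)) (tree_of_mso \<psi> (f(x := N)) g (Suc N)) \<longleftrightarrow>
      mso_sat r (v(x := a)) A \<psi>" if "s \<in> nodes n ?R" "code s 1 = {Some a}" for s a
    using that MEx.prems by (intro MEx.IH) (auto simp: less_Suc_eq)
  have "tree_sat n ?R e (tree_of_mso (MEx x \<psi>) f g N) \<longleftrightarrow>
      (\<exists>s \<in> nodes n ?R. (\<exists>c. code s 1 = {c}) \<and>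
         tree_sat n ?R (e(N := s)) (tree_of_mso \<psi> (f(x := N)) g (Suc N)))"
    by (simp add: tree_sat_tree_single[OF Well_order_ord_succ[OF wo]])
  also have "\<dots> \<longleftrightarrow> (\<exists>a \<in> Field r. mso_sat r (v(x := a)) A \<psi>)"
  proof
    assume "\<exists>s \<in> nodes n ?R. (\<exists>c. code s 1 = {c}) \<and>
         tree_sat n ?R (e(N := s)) (tree_of_mso \<psi> (f(x := N)) g (Suc N))"
    then obtain s c where s: "s \<in> nodes n ?R" "code s 1 = {c}"
      "tree_sat n ?R (e(N := s)) (tree_of_mso \<psi> (f(x := N)) g (Suc N))" by blast
    \<comment> \<open>A position carrying 1 is never \<open>None\<close>, so the singleton does name
      an element of \<alpha>.\<close>
    then obtain a where "c = Some a" "a \<in> Field r" using code_ord_succ_subset[of s n r 1] by auto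
    then show "\<exists>a \<in> Field r. mso_sat r (v(x := a)) A \<psi>" using IH s by auto
  next
    assume "\<exists>a \<in> Field r. mso_sat r (v(x := a)) A \<psi>"
    then obtain a where a: "a \<in> Field r" "mso_sat r (v(x := a)) A \<psi>" by blast
    then show "\<exists>s \<in> nodes n ?R. (\<exists>c. code s 1 = {c}) \<and>
         tree_sat n ?R (e(N := s)) (tree_of_mso \<psi> (f(x := N)) g (Suc N))"
      using IH char_node_in_nodes[OF n] code_char_node[of "{a}" r]
      by (intro bexI[of _ "char_node r {a}"]) auto
  qed
  finally show ?case by simp
next
  case (MExSet X \<psi>)
  let ?R = "ord_succ r"
  have IH: "tree_sat n ?R (e(N := s)) (tree_of_mso \<psi> f (g(X := N)) (Suc N)) \<longleftrightarrow>
      mso_sat r v (A(X := B)) \<psi>" if "s \<in> nodes n ?R" "code s 1 = Some ` B" for s B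
    using that MExSet.prems by (intro MExSet.IH) (auto simp: less_Suc_eq)
  show ?case
  proof
    assume "tree_sat n ?R e (tree_of_mso (MExSet X \<psi>) f g N)"
    then obtain s where s: "s \<in> nodes n ?R"
      "tree_sat n ?R (e(N := s)) (tree_of_mso \<psi> f (g(X := N)) (Suc N))" by auto
    then obtain B where "B \<subseteq> Field r" "code s 1 = Some ` B"
      using code_ord_succ_subset[of s n r 1] by (meson subset_imageE)
    then show "mso_sat r v A (MExSet X \<psi>)" using IH s by auto
  next
    assume "mso_sat r v A (MExSet X \<psi>)"
    then obtain B where B: "B \<subseteq> Field r" "mso_sat r v (A(X := B)) \<psi>" by auto
    have "char_node r B \<in> nodes n ?R" using n by (rule char_node_in_nodes)
    then show "tree_sat n ?R e (tree_of_mso (MExSet X \<psi>) f g N)"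
      using IH[OF _ code_char_node[OF B(1)]] B(2) by auto
  qed
qed simp_all

theorem theorem24:
  fixes n :: nat and r :: "'a rel"
  assumes "n \<ge> 2" and "Well_order r"
  shows
    "(\<forall>\<phi> k. form_over n \<phi> \<and> sim_free \<phi> \<and> tree_fv \<phi> \<subseteq> {..<k} \<longrightarrow>
        (\<exists>\<phi>'. mso_fv \<phi>' = {} \<and> mso_set_fv \<phi>' \<subseteq> {..<k * n} \<and>
           (\<forall>s v. (\<forall>j<k. s j \<in> nodes n r) \<longrightarrow>
              (tree_sat n r s \<phi> \<longleftrightarrow> mso_sat r v (code_env n s) \<phi>'))))
   \<and> (\<forall>\<psi> k l. mso_fv \<psi> \<subseteq> {..<k} \<and> mso_set_fv \<psi> \<subseteq> {..<l} \<longrightarrow>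
        (\<exists>\<psi>'. form_over n \<psi>' \<and> relational \<psi>' \<and> tree_fv \<psi>' \<subseteq> {..<k + l} \<and>
           (\<forall>v A. (\<forall>j<k. v j \<in> Field r) \<and> (\<forall>j<l. A j \<subseteq> Field r) \<longrightarrow>
              (mso_sat r v A \<psi> \<longleftrightarrow> tree_sat n (ord_succ r) (char_env r k v A) \<psi>'))))"
proof (intro conjI allI impI; elim conjE)
  fix \<phi> k
  assume \<phi>: "form_over n \<phi>" "tree_fv \<phi> \<subseteq> {..<k}"
  have n: "0 < n" using assms(1) by simp
  \<comment> \<open>Flattening comes first because \<open>mso_of_tree\<close> looks only at the
    variable of each term.\<close>
  let ?\<phi> = "mso_of_tree n (flatten \<phi>)"
  have "m < k * n" if "m div n < k" for m
    using that n by (simp add: div_less_iff_less_mult)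
  then have "mso_set_fv ?\<phi> \<subseteq> {..<k * n}"
    using mso_set_fv_mso_of_tree[OF n, of "flatten \<phi>"] \<phi>(2) by (auto simp: tree_fv_flatten)
  moreover have "tree_sat n r s \<phi> \<longleftrightarrow> mso_sat r v (code_env n s) ?\<phi>"
    if "\<forall>j<k. s j \<in> nodes n r" for s v
  proof -
    have s: "\<forall>x \<in> tree_fv \<phi>. s x \<in> nodes n r" using that \<phi>(2) by auto
    have "mso_sat r v (code_env n s) ?\<phi> \<longleftrightarrow> tree_sat n r s (flatten \<phi>)"
      using s \<phi>(1) by (intro mso_sat_mso_of_tree[OF assms(2) n])
        (auto simp: relational_flatten form_over_flatten tree_fv_flatten)
    then show ?thesis using tree_sat_flatten[OF s] by simp
  qed
  ultimately show "\<exists>\<phi>'. mso_fv \<phi>' = {} \<and> mso_set_fv \<phi>' \<subseteq> {..<k * n} \<and>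
      (\<forall>s v. (\<forall>j<k. s j \<in> nodes n r) \<longrightarrow>
         (tree_sat n r s \<phi> \<longleftrightarrow> mso_sat r v (code_env n s) \<phi>'))"
    using mso_fv_mso_of_tree by (intro exI[of _ ?\<phi>] conjI allI impI) auto
next
  fix \<psi> k l
  assume \<psi>: "mso_fv \<psi> \<subseteq> {..<k}" "mso_set_fv \<psi> \<subseteq> {..<l}"
  \<comment> \<open>The renaming matches \<open>char_env\<close>: elements keep their numbers below
    \<open>k\<close>, sets are shifted by \<open>k\<close>, and \<open>k + l\<close> is the first
    number left for bound variables.\<close>
  let ?\<psi> = "tree_of_mso \<psi> (\<lambda>x. x) (\<lambda>X. k + X) (k + l)"
  have "tree_fv ?\<psi> \<subseteq> {..<k + l}"
    using \<psi> tree_fv_tree_of_mso[of \<psi> "\<lambda>x. x" "\<lambda>X. k + X" "k + l"] by fastforce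
  moreover have "mso_sat r v A \<psi> \<longleftrightarrow> tree_sat n (ord_succ r) (char_env r k v A) ?\<psi>"
    if "\<forall>j<k. v j \<in> Field r" "\<forall>j<l. A j \<subseteq> Field r" for v A
  proof -
    have "code (char_node r {v x}) 1 = {Some (v x)}" if "x \<in> mso_fv \<psi>" for x
      using code_char_node[of "{v x}" r] \<open>\<forall>j<k. v j \<in> Field r\<close> \<psi>(1) that by auto
    moreover have "code (char_node r (A X)) 1 = Some ` A X" if "X \<in> mso_set_fv \<psi>" for X
      using code_char_node[of "A X" r] \<open>\<forall>j<l. A j \<subseteq> Field r\<close> \<psi>(2) that by auto
    ultimately show ?thesis
      using \<psi> by (intro tree_sat_tree_of_mso[OF assms(2,1), symmetric])
        (auto simp: char_env_def char_node_in_nodes[OF assms(1)])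
  qed
  ultimately show "\<exists>\<psi>'. form_over n \<psi>' \<and> relational \<psi>' \<and> tree_fv \<psi>' \<subseteq> {..<k + l} \<and>
      (\<forall>v A. (\<forall>j<k. v j \<in> Field r) \<and> (\<forall>j<l. A j \<subseteq> Field r) \<longrightarrow>
         (mso_sat r v A \<psi> \<longleftrightarrow> tree_sat n (ord_succ r) (char_env r k v A) \<psi>'))"
    using form_over_tree_of_mso[OF assms(1)] relational_tree_of_mso
    by (intro exI[of _ ?\<psi>] conjI allI impI) auto
qed

end
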